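(* There is a universal constant $c>0$ such that the following holds. Let $n$ be even, $N\le n\log n$ a nonnegative integer, $R>1$, and let $F$ be an $n\times n$ Fourier transform matrix as described in the context. Suppose an $R$-uniformly well conditioned layered circuit on $n+N$ variables has final defining matrix $M=M_m\in\mathbb R^{(n+N)\times(n+N)}$ satisfying $M_{[n],[n]}=F$ and $M_{[n+N]\setminus[n],[n]}=0$. Then the number of rotation gates in the circuit is at least $c\,R^{-1}n\log n$, i.e. $\Omega(R^{-1}n\log n)$.
   Context: All logarithms are base $2$. For a matrix $A$ and index sets $I,J$, $A_{I,J}$ denotes the submatrix with rows $I$ and columns $J$; $[k]=\{1,\dots,k\}$. The first $n$ variables are the input, the remaining $N$ are extra memory (initialized to $0$). Here $F$ denotes either of the following real orthogonal $n\times n$ matrices: (1) the normalized complex DFT of order $n/2$, $\hat F(k,\ell)=(n/2)^{-1/2}e^{-2\pi i(k-1)(\ell-1)/(n/2)}$, written as a real map on $\mathbb R^n$ by storing real parts in $n/2$ coordinates and imaginary parts in the other $n/2$; or (2) the normalized Walsh–Hadamard matrix ($n$ a power of two), $F(i,j)=n^{-1/2}(-1)^{\langle[i-1],[j-1]\rangle}$ with $[a]$ the binary representation and $\langle\cdot,\cdot\rangle$ the dot product over $\mathbb Z_2$. A layered circuit of depth $m$ on $d$ variables has layers $L_0,\dots,L_m\in\mathbb R^d$ and gates $i=1,\dots,m$ of two types: a rotation gate (indices $k_i<\ell_i$ in $[d]$, angle $\theta_i$) leaves all coordinates except $k_i,\ell_i$ unchanged and sets $(L_i(k_i),L_i(\ell_i))^T=\begin{pmatrix}\cos\theta_i&\sin\theta_i\\-\sin\theta_i&\cos\theta_i\end{pmatrix}(L_{i-1}(k_i),L_{i-1}(\ell_i))^T$;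 a constant gate (index $k_i$, nonzero real $c_i$) multiplies coordinate $k_i$ by $c_i$ and leaves others unchanged. The $i$-th defining matrix $M_i$ maps $L_0$ to $L_i$ ($M_0=\mathrm{Id}$). The circuit is $R$-uniformly well conditioned if $\max_{i\in[m]}\|M_i\|\|M_i^{-1}\|\le R$ (spectral norm).
   Formalization: In the DFT case n > 2 is required: for n = 2 the DFT has order 1, F is the 2×2 identity, and the empty circuit computes it with no rotation gates, so the stated bound fails there. Walsh–Hadamard keeps n = 2. *)

theory Defs
  imports Complex_Main
    "Jordan_Normal_Form.Gauss_Jordan_Elimination"
    "Jordan_Normal_Form.DL_Submatrix"
begin

text \<open>Dimensions vary inside the statement, so matrices have explicit carriers.  All indices are
  0-based: the set written \<open>[k]\<close> mathematically is \<open>{..<k}\<close> here.\<close>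

subsection \<open>Spectral norm and condition number\<close>

definition euclid_norm :: "real vec \<Rightarrow> real" where
  "euclid_norm v = sqrt (v \<bullet> v)"

definition spectral_norm :: "real mat \<Rightarrow> real" where
  "spectral_norm A =
     (SUP v \<in> {v \<in> carrier_vec (dim_col A). euclid_norm v \<le> 1}. euclid_norm (A *\<^sub>v v))"

text \<open>Meaningful for invertible matrices only; the defining matrices of valid circuits (below)
  always are invertible.\<close>

definition condition_number :: "real mat \<Rightarrow> real" where
  "condition_number A = spectral_norm A * spectral_norm (the (mat_inverse A))"

subsection \<open>Fourier transform matrices\<close>

definition dft_matrix :: "nat \<Rightarrow> complex mat" where
  "dft_matrix h = mat h h (\<lambda>(k, l).
     exp (- 2 * of_real pi * \<i> * of_nat k * of_nat l / of_nat h) / of_real (sqrt (real h)))"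

text \<open>A layout \<open>p\<close> tells which part of which complex coordinate is kept in which real coordinate:
  \<open>p i = (Re, k)\<close> (respectively \<open>(Im, k)\<close>) means that real coordinate \<open>i\<close> holds the real
  (respectively imaginary) part of the \<open>k\<close>-th complex coordinate.  Storing all real parts before
  all imaginary parts, and interleaving them, are both instances.\<close>

definition storage_layout :: "nat \<Rightarrow> (nat \<Rightarrow> (complex \<Rightarrow> real) \<times> nat) \<Rightarrow> bool" where
  "storage_layout n p \<longleftrightarrow> even n \<and> bij_betw p {..<n} ({Re, Im} \<times> {..<n div 2})"

definition store :: "nat \<Rightarrow> (nat \<Rightarrow> (complex \<Rightarrow> real) \<times> nat) \<Rightarrow> complex vec \<Rightarrow> real vec" where
  "store n p z = vec n (\<lambda>i. fst (p i) (z $ snd (p i)))"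

definition real_dft_matrix :: "nat \<Rightarrow> real mat \<Rightarrow> bool" where
  "real_dft_matrix n F \<longleftrightarrow> F \<in> carrier_mat n n \<and>
     (\<exists>p. storage_layout n p \<and>
       (\<forall>z \<in> carrier_vec (n div 2).
          F *\<^sub>v store n p z = store n p (dft_matrix (n div 2) *\<^sub>v z)))"

text \<open>Dot product over the two-element field of the \<open>k\<close>-bit binary representations.\<close>

definition binary_dot :: "nat \<Rightarrow> nat \<Rightarrow> nat \<Rightarrow> nat" where
  "binary_dot k i j = (\<Sum>b<k. of_bool (bit i b) * of_bool (bit j b)) mod 2"

definition walsh_hadamard_matrix :: "nat \<Rightarrow> real mat \<Rightarrow> bool" where
  "walsh_hadamard_matrix n F \<longleftrightarrow>
     (\<exists>k. n = 2 ^ k \<and> F = mat n n (\<lambda>(i, j). (-1) ^ binary_dot k i j / sqrt (real n)))"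

subsection \<open>Layered circuits\<close>

datatype gate = is_Rotation: Rotation nat nat real | is_Constant: Constant nat real

type_synonym circuit = "gate list"

fun valid_gate :: "nat \<Rightarrow> gate \<Rightarrow> bool" where
  "valid_gate d (Rotation k l \<theta>) \<longleftrightarrow> k < l \<and> l < d"
| "valid_gate d (Constant k c) \<longleftrightarrow> k < d \<and> c \<noteq> 0"

definition valid_circuit :: "nat \<Rightarrow> circuit \<Rightarrow> bool" where
  "valid_circuit d C \<longleftrightarrow> (\<forall>g \<in> set C. valid_gate d g)"

fun apply_gate :: "gate \<Rightarrow> real vec \<Rightarrow> real vec" where
  "apply_gate (Rotation k l \<theta>) v = vec (dim_vec v) (\<lambda>i.
     if i = k then cos \<theta> * v $ k + sin \<theta> * v $ l
     else if i = l then - sin \<theta> * v $ k + cos \<theta> * v $ l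
     else v $ i)"
| "apply_gate (Constant k c) v = vec (dim_vec v) (\<lambda>i. if i = k then c * v $ k else v $ i)"

definition layer :: "circuit \<Rightarrow> nat \<Rightarrow> real vec \<Rightarrow> real vec" where
  "layer C i x = fold apply_gate (take i C) x"

text \<open>The matrix of the linear map sending layer 0 to layer \<open>i\<close>; its columns are the images of the
  unit vectors (see \<open>defining_matrix_mult_vec\<close>).\<close>

definition defining_matrix :: "nat \<Rightarrow> circuit \<Rightarrow> nat \<Rightarrow> real mat" where
  "defining_matrix d C i = mat d d (\<lambda>(r, c). layer C i (unit_vec d c) $ r)"

definition uniformly_well_conditioned :: "nat \<Rightarrow> real \<Rightarrow> circuit \<Rightarrow> bool" where
  "uniformly_well_conditioned d R C \<longleftrightarrow>
     (\<forall>i \<in> {1..length C}. condition_number (defining_matrix d C i) \<le> R)"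

definition rotation_count :: "circuit \<Rightarrow> nat" where
  "rotation_count C = length (filter is_Rotation C)"

lemma apply_gate_linear:
  assumes "valid_gate d g"
  shows "\<exists>A \<in> carrier_mat d d. \<forall>v \<in> carrier_vec d. apply_gate g v = A *\<^sub>v v"
proof -
  define A where "A = mat d d (\<lambda>(r, c). apply_gate g (unit_vec d c) $ r)"
  have "apply_gate g v = A *\<^sub>v v" if v: "v \<in> carrier_vec d" for v
  proof (cases g)
    case (Rotation k l \<theta>)
    have kl: "k < l" "l < d" "k < d" using assms Rotation by auto
    show ?thesis
    proof (rule eq_vecI)
      fix i assume "i < dim_vec (A *\<^sub>v v)"
      then have i: "i < d" by (simp add: A_def)
      have "(A *\<^sub>v v) $ i = (\<Sum>c<d. apply_gate g (unit_vec d c) $ i * v $ c)"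
        using v i by (auto simp: A_def scalar_prod_def atLeast0LessThan)
      also have "\<dots> = (\<Sum>c<d.
           (if i = k then cos \<theta> * (if c = k then v $ c else 0) + sin \<theta> * (if c = l then v $ c else 0)
            else if i = l then - sin \<theta> * (if c = k then v $ c else 0) + cos \<theta> * (if c = l then v $ c else 0)
            else (if c = i then v $ c else 0)))"
        using i kl by (intro sum.cong) (auto simp: Rotation algebra_simps)
      also have "\<dots> = apply_gate g v $ i"
        using i kl v by (auto simp: Rotation sum.distrib sum_distrib_left[symmetric] sum_negf sum_subtractf)
      finally show "apply_gate g v $ i = (A *\<^sub>v v) $ i" by simp
    qed (use v in \<open>simp add: A_def Rotation\<close>)
  next
    case (Constant k a)
    show ?thesis
    proof (rule eq_vecI)
      fix i assume "i < dim_vec (A *\<^sub>v v)"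
      then have i: "i < d" by (simp add: A_def)
      have "(A *\<^sub>v v) $ i = (\<Sum>c<d. apply_gate g (unit_vec d c) $ i * v $ c)"
        using v i by (auto simp: A_def scalar_prod_def atLeast0LessThan)
      also have "\<dots> = (\<Sum>c<d. if c = i then (if i = k then a else 1) * v $ c else 0)"
        using i assms by (intro sum.cong) (auto simp: Constant)
      also have "\<dots> = apply_gate g v $ i"
        using i v by (auto simp: Constant)
      finally show "apply_gate g v $ i = (A *\<^sub>v v) $ i" by simp
    qed (use v in \<open>simp add: A_def Constant\<close>)
  qed
  moreover have "A \<in> carrier_mat d d" by (simp add: A_def)
  ultimately show ?thesis by blast
qed

lemma defining_matrix_mult_vec:
  assumes "valid_circuit d C" "x \<in> carrier_vec d"
  shows "defining_matrix d C i *\<^sub>v x = layer C i x"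
proof -
  have fold_linear:
    "\<exists>A \<in> carrier_mat d d. \<forall>v \<in> carrier_vec d. fold apply_gate gs v = A *\<^sub>v v"
    if "\<forall>g \<in> set gs. valid_gate d g" for gs
    using that
  proof (induction gs)
    case Nil
    show ?case by (intro bexI[of _ "1\<^sub>m d"]) auto
  next
    case (Cons g gs)
    have g: "valid_gate d g" and gs: "\<forall>g \<in> set gs. valid_gate d g"
      using Cons.prems by simp_all
    obtain A where A: "A \<in> carrier_mat d d" "\<forall>v \<in> carrier_vec d. apply_gate g v = A *\<^sub>v v"
      using apply_gate_linear[OF g] by blast
    obtain B where B: "B \<in> carrier_mat d d" "\<forall>v \<in> carrier_vec d. fold apply_gate gs v = B *\<^sub>v v"
      using Cons.IH[OF gs] by blast
    have "fold apply_gate (g # gs) v = (B * A) *\<^sub>v v" if v: "v \<in> carrier_vec d" for v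
    proof -
      have "A *\<^sub>v v \<in> carrier_vec d"
        using A(1) v by (rule mult_mat_vec_carrier)
      then show ?thesis
        using A(2) B(2) v by (simp add: assoc_mult_mat_vec[OF B(1) A(1) v])
    qed
    then show ?case
      using mult_carrier_mat[OF B(1) A(1)] by blast
  qed
  have "\<forall>g \<in> set (take i C). valid_gate d g"
    using assms(1) by (auto simp: valid_circuit_def dest: in_set_takeD)
  then obtain A where A: "A \<in> carrier_mat d d"
    "\<And>v. v \<in> carrier_vec d \<Longrightarrow> layer C i v = A *\<^sub>v v"
    using fold_linear unfolding layer_def by blast
  have "defining_matrix d C i = A"
    using A(1) by (intro eq_matI) (auto simp: defining_matrix_def A(2))
  then show ?thesis using A(2) assms(2) by simp
qed

text \<open>The real map of the DFT of order 1 is the identity, which the empty circuit computes: a lower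
  bound for the DFT that vanishes nowhere can only hold for order at least 2.\<close>

lemma real_dft_matrix_2: "real_dft_matrix 2 (1\<^sub>m 2)"
proof -
  define p :: "nat \<Rightarrow> (complex \<Rightarrow> real) \<times> nat" where "p i = (if i = 0 then Re else Im, 0)" for i
  have ne: "Re \<noteq> Im"
  proof
    assume "Re = Im"
    then have "Re 1 = Im 1" by (rule fun_cong)
    then show False by simp
  qed
  have two: "{..<2::nat} = {0, 1}" and one: "{..<1::nat} = {0}" by auto
  have "bij_betw p {..<2} ({Re, Im} \<times> {..<1})"
    unfolding two one bij_betw_def using ne by (simp add: p_def insert_commute)
  then have layout: "storage_layout 2 p"
    by (simp add: storage_layout_def)
  have dft: "dft_matrix 1 = 1\<^sub>m 1"
    by (rule eq_matI) (simp_all add: dft_matrix_def)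
  have "1\<^sub>m 2 *\<^sub>v store 2 p z = store 2 p (dft_matrix (2 div 2) *\<^sub>v z)"
    if "z \<in> carrier_vec (2 div 2)" for z
  proof -
    have "dft_matrix (2 div 2) *\<^sub>v z = z"
      using that dft by simp
    moreover have "store 2 p z \<in> carrier_vec 2"
      by (simp add: store_def)
    ultimately show ?thesis by simp
  qed
  with layout show ?thesis
    unfolding real_dft_matrix_def by auto
qed

lemma defining_matrix_Nil: "defining_matrix d [] i = 1\<^sub>m d"
  by (intro eq_matI) (auto simp: defining_matrix_def layer_def)

end

theory Submission
  imports Defs "Jordan_Normal_Form.Determinant" "HOL-Analysis.L2_Norm"
begin

text \<open>The potential of an invertible matrix \<open>M\<close> is the sum of \<open>- t ln \<bar>t\<bar>\<close> over the entries
  \<open>t = M(r, j) M\<^sup>-\<^sup>T(r, j)\<close> of the input columns. Constant gates scale a row of \<open>M\<close> and a row of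
  \<open>M\<^sup>-\<^sup>T\<close> by inverse factors and leave it unchanged. A rotation acts on both matrices in the same
  way; in column \<open>j\<close> it preserves \<open>\<Sum> t\<close> over the two affected rows, so after rescaling by the
  product of the norms of the two affected pairs it changes the potential by at most four times that
  product. By Cauchy-Schwarz this sums up to at most \<open>8 \<parallel>M\<parallel> \<parallel>M\<^sup>-\<^sup>1\<parallel> \<le> 8 R\<close>. The potential is 0 for
  the identity, while for the final matrix it is the entropy of the squared entries of \<open>F\<close>, which is
  at least \<open>n ln (n / 2)\<close> for the DFT and \<open>n ln n\<close> for Walsh-Hadamard.\<close>

subsection \<open>The entropy function\<close>

text \<open>Products of an entry of \<open>M\<close> with one of its inverse transpose can be
  negative, hence the absolute value: this is the odd extension of the Shannon entropy summand, in
  natural logarithms.\<close>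

definition entropy_term :: "real \<Rightarrow> real" where
  "entropy_term t = - t * ln \<bar>t\<bar>"

lemma entropy_term_0 [simp]: "entropy_term 0 = 0"
  by (simp add: entropy_term_def)

lemma entropy_term_1 [simp]: "entropy_term 1 = 0"
  by (simp add: entropy_term_def)

text \<open>By \<open>ln x \<le> x - 1\<close> at \<open>x = 1 / \<bar>t\<bar>\<close>. The true
  maximum is 1/e; the cruder 1 costs only a constant.\<close>

lemma abs_entropy_term_le_1:
  assumes "\<bar>t\<bar> \<le> 1"
  shows "\<bar>entropy_term t\<bar> \<le> 1"
proof (cases "t = 0")
  case False
  have "ln (1 / \<bar>t\<bar>) \<le> 1 / \<bar>t\<bar> - 1"
    using False by (intro ln_le_minus_one) simp
  moreover have "ln (1 / \<bar>t\<bar>) = - ln \<bar>t\<bar>" "ln \<bar>t\<bar> \<le> 0"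
    using False assms by (simp_all add: ln_div)
  ultimately have "\<bar>t\<bar> * \<bar>ln \<bar>t\<bar>\<bar> \<le> \<bar>t\<bar> * (1 / \<bar>t\<bar> - 1)"
    by (intro mult_left_mono) auto
  also have "\<dots> \<le> 1"
    using False by (simp add: right_diff_distrib)
  finally show ?thesis
    by (simp add: entropy_term_def abs_mult)
qed simp

text \<open>The correction term is linear in \<open>a\<close>, so it cancels when two families of
  arguments with equal sums are compared.\<close>

lemma entropy_term_mult:
  assumes "P > 0"
  shows "entropy_term (P * a) = P * entropy_term a - P * a * ln P"
proof (cases "a = 0")
  case False
  then show ?thesis
    using assms by (simp add: entropy_term_def abs_mult ln_mult algebra_simps)
qed simp

text \<open>A small nonzero entry has \<open>- ln (x\<^sup>2)\<close> at least \<open>ln H\<close>;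
  weighted by squares and summed over a unit column, this yields entropy at least
  \<open>ln H\<close>.\<close>

lemma entropy_term_square_ge:
  assumes "x\<^sup>2 \<le> 1 / H" "H > 0"
  shows "entropy_term (x * x) \<ge> x\<^sup>2 * ln H"
proof (cases "x = 0")
  case False
  then have "ln (x\<^sup>2) \<le> ln (1 / H)"
    using assms by (subst ln_le_cancel_iff) auto
  then have "ln (x\<^sup>2) \<le> - ln H"
    using assms by (simp add: ln_div)
  then have "x\<^sup>2 * ln H \<le> x\<^sup>2 * - ln (x\<^sup>2)"
    by (intro mult_left_mono) auto
  then show ?thesis
    by (simp add: entropy_term_def power2_eq_square)
qed simp

text \<open>\<open>x\<close>, \<open>y\<close> are the two affected entries in a column of
  \<open>M\<close> and of its inverse transpose before a rotation, \<open>u\<close>,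
  \<open>v\<close> those after it. Divided by the product \<open>P\<close> of the pair norms, all
  four products lie in [-1, 1], so each entropy term contributes at most 1.\<close>

lemma rotation_entropy_change:
  assumes x: "x1\<^sup>2 + x2\<^sup>2 = u1\<^sup>2 + u2\<^sup>2" and y: "y1\<^sup>2 + y2\<^sup>2 = v1\<^sup>2 + v2\<^sup>2"
    and xy: "x1 * y1 + x2 * y2 = u1 * v1 + u2 * v2"
  shows "entropy_term (u1 * v1) + entropy_term (u2 * v2)
    \<le> entropy_term (x1 * y1) + entropy_term (x2 * y2)
      + 4 * (sqrt (u1\<^sup>2 + u2\<^sup>2) * sqrt (v1\<^sup>2 + v2\<^sup>2))"
proof -
  define P where "P = sqrt (u1\<^sup>2 + u2\<^sup>2) * sqrt (v1\<^sup>2 + v2\<^sup>2)"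
  have P_ge: "P \<ge> 0" by (simp add: P_def)
  have le: "\<bar>a * b\<bar> \<le> P"
    if "a\<^sup>2 \<le> u1\<^sup>2 + u2\<^sup>2" "b\<^sup>2 \<le> v1\<^sup>2 + v2\<^sup>2" for a b
    unfolding P_def abs_mult using that
    by (intro mult_mono real_le_rsqrt) auto
  have b: "\<bar>u1 * v1\<bar> \<le> P" "\<bar>u2 * v2\<bar> \<le> P" "\<bar>x1 * y1\<bar> \<le> P" "\<bar>x2 * y2\<bar> \<le> P"
    using x y zero_le_power2[of u1] zero_le_power2[of u2] zero_le_power2[of v1] zero_le_power2[of v2]
      zero_le_power2[of x1] zero_le_power2[of x2] zero_le_power2[of y1] zero_le_power2[of y2]
    by (intro le; linarith)+
  show ?thesis
  proof (cases "P = 0")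
    \<comment> \<open>No rescaling is possible, but then all four products vanish.\<close>
    case True
    then have zero: "u1 * v1 = 0" "u2 * v2 = 0" "x1 * y1 = 0" "x2 * y2 = 0"
      using b by (simp_all only: abs_le_zero_iff)
    show ?thesis
      unfolding zero using P_ge by (simp flip: P_def)
  next
    case False
    with P_ge have P: "P > 0" by simp
    have scale: "entropy_term t = P * entropy_term (t / P) - t * ln P" for t
      using entropy_term_mult[OF P, of "t / P"] P by simp
    have bnd: "\<bar>entropy_term (t / P)\<bar> \<le> 1" if "\<bar>t\<bar> \<le> P" for t
      using that P by (intro abs_entropy_term_le_1) simp
    have "entropy_term (u1 * v1) + entropy_term (u2 * v2)
        - (entropy_term (x1 * y1) + entropy_term (x2 * y2))
      = P * (entropy_term (u1 * v1 / P) + entropy_term (u2 * v2 / P)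
        - entropy_term (x1 * y1 / P) - entropy_term (x2 * y2 / P))
        + (x1 * y1 + x2 * y2 - (u1 * v1 + u2 * v2)) * ln P"
      unfolding scale[of "u1 * v1"] scale[of "u2 * v2"] scale[of "x1 * y1"] scale[of "x2 * y2"]
      by (simp add: algebra_simps)
    \<comment> \<open>The logarithm of the scale multiplies only the change in the sum of products,
      which is zero.\<close>
    also have "\<dots> = P * (entropy_term (u1 * v1 / P) + entropy_term (u2 * v2 / P)
        - entropy_term (x1 * y1 / P) - entropy_term (x2 * y2 / P))"
      by (simp add: xy)
    also have "\<dots> \<le> P * 4"
      using P bnd[OF b(1)] bnd[OF b(2)] bnd[OF b(3)] bnd[OF b(4)]
      by (intro mult_left_mono) linarith+
    finally show ?thesis by (simp add: P_def)
  qed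
qed

subsection \<open>Spectral norms\<close>

lemma euclid_norm_power2: "(euclid_norm v)\<^sup>2 = (\<Sum>i<dim_vec v. (v $ i)\<^sup>2)"
  by (simp add: euclid_norm_def scalar_prod_def sum_nonneg power2_eq_square atLeast0LessThan)

lemma euclid_norm_nonneg [simp]: "euclid_norm v \<ge> 0"
  by (simp add: euclid_norm_def scalar_prod_def sum_nonneg)

lemma abs_index_le_euclid_norm:
  assumes "i < dim_vec v"
  shows "\<bar>v $ i\<bar> \<le> euclid_norm v"
proof -
  have "(v $ i)\<^sup>2 \<le> (euclid_norm v)\<^sup>2"
    unfolding euclid_norm_power2 using assms by (intro member_le_sum) auto
  then show ?thesis
    using abs_le_square_iff[of "v $ i" "euclid_norm v"] by simp
qed

text \<open>Only boundedness matters here: it makes the supremum defining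
  \<open>spectral_norm\<close> an actual upper bound.\<close>

lemma euclid_norm_mult_mat_vec_le:
  assumes "v \<in> carrier_vec (dim_col A)" "euclid_norm v \<le> 1"
  shows "euclid_norm (A *\<^sub>v v) \<le> (\<Sum>i<dim_row A. \<Sum>j<dim_col A. \<bar>A $$ (i, j)\<bar>)"
proof -
  let ?w = "A *\<^sub>v v"
  have "euclid_norm ?w = L2_set (\<lambda>i. ?w $ i) {..<dim_row A}"
    using real_sqrt_unique[OF euclid_norm_power2[of ?w]] by (simp add: L2_set_def del: index_mult_mat_vec)
  also have "\<dots> \<le> (\<Sum>i<dim_row A. \<bar>?w $ i\<bar>)"
    by (rule L2_set_le_sum_abs)
  also have "\<dots> \<le> (\<Sum>i<dim_row A. \<Sum>j<dim_col A. \<bar>A $$ (i, j)\<bar>)"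
  proof (rule sum_mono)
    fix i assume i: "i \<in> {..<dim_row A}"
    have "\<bar>?w $ i\<bar> = \<bar>\<Sum>j<dim_col A. A $$ (i, j) * v $ j\<bar>"
      using i assms(1) by (auto simp: scalar_prod_def atLeast0LessThan)
    also have "\<dots> \<le> (\<Sum>j<dim_col A. \<bar>A $$ (i, j) * v $ j\<bar>)"
      by (rule sum_abs)
    also have "\<dots> \<le> (\<Sum>j<dim_col A. \<bar>A $$ (i, j)\<bar>)"
    proof (rule sum_mono)
      fix j assume "j \<in> {..<dim_col A}"
      then have "\<bar>v $ j\<bar> \<le> 1"
        using abs_index_le_euclid_norm[of j v] assms by auto
      then show "\<bar>A $$ (i, j) * v $ j\<bar> \<le> \<bar>A $$ (i, j)\<bar>"
        by (simp add: abs_mult mult_left_le)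
    qed
    finally show "\<bar>?w $ i\<bar> \<le> (\<Sum>j<dim_col A. \<bar>A $$ (i, j)\<bar>)" .
  qed
  finally show ?thesis .
qed

lemma euclid_norm_le_spectral_norm:
  assumes "v \<in> carrier_vec (dim_col A)" "euclid_norm v \<le> 1"
  shows "euclid_norm (A *\<^sub>v v) \<le> spectral_norm A"
  unfolding spectral_norm_def
  by (rule cSUP_upper) (use assms euclid_norm_mult_mat_vec_le[of _ A] in \<open>auto intro!: bdd_aboveI\<close>)

text \<open>A column is the image of a unit vector.\<close>

lemma col_norm_le_spectral_norm:
  assumes "A \<in> carrier_mat d d" "j < d"
  shows "(\<Sum>i<d. (A $$ (i, j))\<^sup>2) \<le> (spectral_norm A)\<^sup>2"
proof -
  have "euclid_norm (unit_vec d j) = 1"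
    using assms(2) by (simp add: euclid_norm_def)
  then have "euclid_norm (A *\<^sub>v unit_vec d j) \<le> spectral_norm A"
    using assms by (intro euclid_norm_le_spectral_norm) auto
  then have "(euclid_norm (A *\<^sub>v unit_vec d j))\<^sup>2 \<le> (spectral_norm A)\<^sup>2"
    by (intro power_mono) auto
  then show ?thesis
    using assms by (simp add: euclid_norm_power2)
qed

lemma spectral_norm_nonneg: "spectral_norm A \<ge> 0"
proof -
  have "euclid_norm (0\<^sub>v (dim_col A)) \<le> 1" by (simp add: euclid_norm_def)
  then have "euclid_norm (A *\<^sub>v 0\<^sub>v (dim_col A)) \<le> spectral_norm A"
    by (intro euclid_norm_le_spectral_norm) auto
  then show ?thesis
    using euclid_norm_nonneg order_trans by blast
qed

text \<open>Testing \<open>A\<close> on its own row, normalised, gives a vector whose coordinate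
  \<open>i\<close> is the norm of that row.\<close>

lemma row_norm_le_spectral_norm:
  assumes A: "A \<in> carrier_mat d d" and i: "i < d"
  shows "(\<Sum>j<d. (A $$ (i, j))\<^sup>2) \<le> (spectral_norm A)\<^sup>2"
proof -
  define r where "r = row A i"
  define s where "s = euclid_norm r"
  have r: "r \<in> carrier_vec d" using A by (auto simp: r_def)
  have s2: "s\<^sup>2 = (\<Sum>j<d. (A $$ (i, j))\<^sup>2)"
    using A i by (simp add: s_def r_def euclid_norm_power2)
  have rr: "r \<bullet> r = s\<^sup>2"
    by (simp add: s_def euclid_norm_def scalar_prod_def sum_nonneg)
  have "s \<le> spectral_norm A"
  proof (cases "s = 0")
    case False
    define v where "v = (1 / s) \<cdot>\<^sub>v r"
    have v: "v \<in> carrier_vec d" using r by (simp add: v_def)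
    have "v \<bullet> v = 1"
      using r False by (simp add: v_def rr power2_eq_square)
    then have "euclid_norm (A *\<^sub>v v) \<le> spectral_norm A"
      using A v by (intro euclid_norm_le_spectral_norm) (auto simp: euclid_norm_def)
    moreover have "\<bar>(A *\<^sub>v v) $ i\<bar> \<le> euclid_norm (A *\<^sub>v v)"
      using A i by (intro abs_index_le_euclid_norm) auto
    moreover have "(A *\<^sub>v v) $ i = s"
      using A i r False by (simp add: v_def rr power2_eq_square flip: r_def)
    ultimately show ?thesis by simp
  qed (simp add: spectral_norm_nonneg)
  then have "s\<^sup>2 \<le> (spectral_norm A)\<^sup>2"
    by (intro power_mono) (auto simp: s_def)
  then show ?thesis by (simp add: s2)
qed

subsection \<open>The contragredient circuit\<close>

text \<open>Rotations are their own inverse transpose, so inverting the constants turns the defining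
  matrix \<open>M\<close> into the inverse of its transpose.\<close>

fun dual_gate :: "gate \<Rightarrow> gate" where
  "dual_gate (Rotation k l \<theta>) = Rotation k l \<theta>"
| "dual_gate (Constant k c) = Constant k (inverse c)"

lemma dim_apply_gate [simp]: "dim_vec (apply_gate g v) = dim_vec v"
  by (cases g) auto

lemma dim_layer [simp]: "dim_vec (layer C i v) = dim_vec v"
proof -
  have "dim_vec (fold apply_gate gs v) = dim_vec v" for gs
    by (induction gs arbitrary: v) auto
  then show ?thesis by (simp add: layer_def)
qed

lemma layer_0 [simp]: "layer C 0 v = v"
  by (simp add: layer_def)

lemma valid_gate_nth:
  "valid_circuit d C \<Longrightarrow> i < length C \<Longrightarrow> valid_gate d (C ! i)"
  by (simp add: valid_circuit_def)

lemma layer_Suc: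
  assumes "i < length C"
  shows "layer C (Suc i) v = apply_gate (C ! i) (layer C i v)"
  using assms by (simp add: layer_def take_Suc_conv_app_nth)

lemma sum_split_two:
  fixes f :: "nat \<Rightarrow> real"
  assumes "k < l" "l < d"
  shows "(\<Sum>i<d. f i) = f k + f l + (\<Sum>i\<in>{..<d} - {k, l}. f i)"
proof -
  have "(\<Sum>i<d. f i) = f k + (\<Sum>i\<in>{..<d} - {k}. f i)"
    using assms by (intro sum.remove) auto
  also have "(\<Sum>i\<in>{..<d} - {k}. f i) = f l + (\<Sum>i\<in>{..<d} - {k} - {l}. f i)"
    using assms by (intro sum.remove) auto
  also have "{..<d} - {k} - {l} = {..<d} - {k, l}" by auto
  finally show ?thesis by simp
qed

text \<open>Rotations are orthogonal: the terms in \<open>sin t * cos t\<close> cancel and the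
  squares add to 1. With equal pairs this is preservation of the norm.\<close>

lemma rotation_preserves_product:
  fixes t :: real
  shows "(cos t * a + sin t * b) * (cos t * a' + sin t * b')
    + (cos t * b - sin t * a) * (cos t * b' - sin t * a') = a * a' + b * b'"
proof -
  have "(cos t * a + sin t * b) * (cos t * a' + sin t * b')
    + (cos t * b - sin t * a) * (cos t * b' - sin t * a')
    = ((sin t)\<^sup>2 + (cos t)\<^sup>2) * (a * a' + b * b')"
    by (simp only: power2_eq_square) (simp only: algebra_simps)
  then show ?thesis by simp
qed

text \<open>A rotation acts on both vectors by the same orthogonal map, while the factors
  \<open>c\<close> and \<open>inverse c\<close> of a constant gate cancel, validity giving
  \<open>c \<noteq> 0\<close>.\<close>

lemma dual_gate_preserves_product:
  assumes "valid_gate d g" "u \<in> carrier_vec d" "v \<in> carrier_vec d"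
  shows "(\<Sum>r<d. apply_gate g u $ r * apply_gate (dual_gate g) v $ r) = (\<Sum>r<d. u $ r * v $ r)"
proof (cases g)
  case (Rotation k l t)
  with assms have kl: "k < l" "l < d" by auto
  have "(\<Sum>i\<in>{..<d} - {k, l}. apply_gate g u $ i * apply_gate (dual_gate g) v $ i)
    = (\<Sum>i\<in>{..<d} - {k, l}. u $ i * v $ i)"
    using assms by (intro sum.cong) (auto simp: Rotation)
  then show ?thesis
    using kl assms rotation_preserves_product[of t "u $ k" "u $ l" "v $ k" "v $ l"]
    by (simp add: sum_split_two[OF kl] Rotation)
next
  case (Constant k c)
  then show ?thesis
    using assms by (intro sum.cong) (auto simp: Constant)
qed

abbreviation dual_circuit :: "circuit \<Rightarrow> circuit" where
  "dual_circuit \<equiv> map dual_gate"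

lemma dual_circuit_preserves_product:
  assumes "valid_circuit d C" "u \<in> carrier_vec d" "v \<in> carrier_vec d" "i \<le> length C"
  shows "(\<Sum>r<d. layer C i u $ r * layer (dual_circuit C) i v $ r) = (\<Sum>r<d. u $ r * v $ r)"
  using assms(4)
proof (induction i)
  case (Suc i)
  then have i: "i < length C" and valid: "valid_gate d (C ! i)"
    using valid_gate_nth[OF assms(1)] by simp_all
  have "layer C i u \<in> carrier_vec d" "layer (dual_circuit C) i v \<in> carrier_vec d"
    using assms(2,3) by (auto intro!: carrier_vecI)
  from dual_gate_preserves_product[OF valid this] show ?case
    using Suc.IH i by (simp add: layer_Suc)
qed simp

text \<open>Invariance of the pairing, applied to unit vectors, makes the columns of the two
  defining matrices biorthogonal.\<close>

lemma transpose_dual_circuit_inverse: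
  assumes "valid_circuit d C" "i \<le> length C"
  shows "transpose_mat (defining_matrix d (dual_circuit C) i) * defining_matrix d C i = 1\<^sub>m d"
proof (rule eq_matI)
  fix a b assume "a < dim_row (1\<^sub>m d :: real mat)" "b < dim_col (1\<^sub>m d :: real mat)"
  then have ab: "a < d" "b < d" by auto
  have "(transpose_mat (defining_matrix d (dual_circuit C) i) * defining_matrix d C i) $$ (a, b)
    = (\<Sum>r<d. layer C i (unit_vec d b) $ r * layer (dual_circuit C) i (unit_vec d a) $ r)"
    using ab by (simp add: defining_matrix_def scalar_prod_def atLeast0LessThan mult.commute)
  also have "\<dots> = (\<Sum>r<d. unit_vec d b $ r * unit_vec d a $ r)"
    by (rule dual_circuit_preserves_product) (use assms in auto)
  also have "\<dots> = (\<Sum>r<d. if r = a then (if a = b then 1 else 0) else 0)"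
    using ab by (intro sum.cong) auto
  also have "\<dots> = 1\<^sub>m d $$ (a, b)"
    using ab by simp
  finally show "(transpose_mat (defining_matrix d (dual_circuit C) i) * defining_matrix d C i) $$ (a, b)
    = 1\<^sub>m d $$ (a, b)" .
qed (auto simp: defining_matrix_def)

text \<open>\<open>mat_inverse\<close> is the optional result of Gauss-Jordan elimination. A
  two-sided inverse rules out \<open>None\<close>, and uniqueness of inverses identifies the
  result.\<close>

lemma the_mat_inverse_eq:
  fixes A B :: "real mat"
  assumes A: "A \<in> carrier_mat d d" and B: "B \<in> carrier_mat d d" and BA: "B * A = 1\<^sub>m d"
  shows "the (mat_inverse A) = B"
proof -
  have AB: "A * B = 1\<^sub>m d"
    using mat_mult_left_right_inverse[OF B A BA] .
  show ?thesis
  proof (cases "mat_inverse A")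
    case None
    have "A \<in> Units (ring_mat TYPE(real) d ())"
      using A B AB BA by (auto simp: Units_def ring_mat_def)
    then show ?thesis
      using mat_inverse(1)[OF A None, where b = "()"] by simp
  next
    case (Some X)
    then have X: "X * A = 1\<^sub>m d" "X \<in> carrier_mat d d"
      using mat_inverse(2)[OF A] by auto
    have "X = X * (A * B)" using X by (simp add: AB)
    also have "\<dots> = B" using X A B by (simp flip: assoc_mult_mat[OF X(2) A B])
    finally show ?thesis using Some by simp
  qed
qed

text \<open>The rows of \<open>B\<close> are the columns of the inverse of \<open>A\<close>. Each of
  these norms is at most a spectral norm, so a pair of them costs a factor \<open>sqrt 2\<close> for
  each matrix.\<close>

lemma row_norms_le_condition_number:
  assumes C: "valid_circuit d C" "i \<le> length C" and r: "r < d" "s < d"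
  defines "A \<equiv> defining_matrix d C i" and "B \<equiv> defining_matrix d (dual_circuit C) i"
  shows "sqrt (\<Sum>j<d. (A $$ (r, j))\<^sup>2 + (A $$ (s, j))\<^sup>2)
      * sqrt (\<Sum>j<d. (B $$ (r, j))\<^sup>2 + (B $$ (s, j))\<^sup>2) \<le> 2 * condition_number A"
proof -
  have A: "A \<in> carrier_mat d d" and B: "B \<in> carrier_mat d d"
    by (auto simp: A_def B_def defining_matrix_def)
  have inv: "the (mat_inverse A) = transpose_mat B"
    using transpose_dual_circuit_inverse[OF C] A B
    by (intro the_mat_inverse_eq) (auto simp: A_def B_def)
  have "(\<Sum>j<d. (A $$ (r, j))\<^sup>2 + (A $$ (s, j))\<^sup>2) \<le> 2 * (spectral_norm A)\<^sup>2"
    using row_norm_le_spectral_norm[OF A r(1)] row_norm_le_spectral_norm[OF A r(2)]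
    by (simp add: sum.distrib)
  then have a: "sqrt (\<Sum>j<d. (A $$ (r, j))\<^sup>2 + (A $$ (s, j))\<^sup>2) \<le> sqrt 2 * spectral_norm A"
    by (intro real_le_lsqrt) (auto simp: sum_nonneg power_mult_distrib spectral_norm_nonneg)
  have BT: "transpose_mat B \<in> carrier_mat d d" using B by simp
  have "(\<Sum>j<d. (B $$ (r, j))\<^sup>2 + (B $$ (s, j))\<^sup>2) \<le> 2 * (spectral_norm (transpose_mat B))\<^sup>2"
    using col_norm_le_spectral_norm[OF BT r(1)] col_norm_le_spectral_norm[OF BT r(2)] B r
    by (simp add: sum.distrib)
  then have b: "sqrt (\<Sum>j<d. (B $$ (r, j))\<^sup>2 + (B $$ (s, j))\<^sup>2) \<le> sqrt 2 * spectral_norm (transpose_mat B)"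
    by (intro real_le_lsqrt) (auto simp: sum_nonneg power_mult_distrib spectral_norm_nonneg)
  have "sqrt (\<Sum>j<d. (A $$ (r, j))\<^sup>2 + (A $$ (s, j))\<^sup>2)
      * sqrt (\<Sum>j<d. (B $$ (r, j))\<^sup>2 + (B $$ (s, j))\<^sup>2)
    \<le> (sqrt 2 * spectral_norm A) * (sqrt 2 * spectral_norm (transpose_mat B))"
    using a b by (intro mult_mono) (auto simp: sum_nonneg spectral_norm_nonneg)
  also have "\<dots> = 2 * condition_number A"
    by (simp add: condition_number_def inv)
  finally show ?thesis .
qed

subsection \<open>The potential\<close>

text \<open>Restricting to the input columns keeps the columns of the final matrix that belong to the extra
  memory, about which nothing is known, out of the potential.\<close>

definition potential :: "nat \<Rightarrow> nat \<Rightarrow> circuit \<Rightarrow> nat \<Rightarrow> real" where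
  "potential d n C i = (\<Sum>j<n. \<Sum>r<d. entropy_term
     (defining_matrix d C i $$ (r, j) * defining_matrix d (dual_circuit C) i $$ (r, j)))"

text \<open>Both matrices are the identity, so all products are 0 or 1, where the entropy
  vanishes.\<close>

lemma potential_0: "n \<le> d \<Longrightarrow> potential d n C 0 = 0"
  by (auto simp: potential_def defining_matrix_def intro!: sum.neutral)

lemma defining_matrix_Suc:
  assumes "i < length C" "r < d" "j < d"
  shows "defining_matrix d C (Suc i) $$ (r, j) = apply_gate (C ! i) (layer C i (unit_vec d j)) $ r"
  using assms by (simp add: defining_matrix_def layer_Suc)

lemma potential_Suc_Constant:
  assumes "valid_circuit d C" "i < length C" "n \<le> d" "C ! i = Constant k c"
  shows "potential d n C (Suc i) = potential d n C i"
proof -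
  have "valid_gate d (C ! i)"
    using assms(1,2) by (rule valid_gate_nth)
  with assms have "c \<noteq> 0" by simp
  then have cancel: "c * x * (inverse c * y) = x * y" for x y
    by simp
  show ?thesis
    unfolding potential_def using assms
    by (intro sum.cong) (auto simp: cancel defining_matrix_def layer_Suc)
qed

text \<open>The 8 combines the 4 of \<open>rotation_entropy_change\<close> with the 2 of
  \<open>row_norms_le_condition_number\<close>. The condition number is taken after the gate because
  \<open>uniformly_well_conditioned\<close> speaks of the layers from 1 on.\<close>

lemma potential_Suc_Rotation:
  assumes C: "valid_circuit d C" and i: "i < length C" and n: "n \<le> d"
    and g: "C ! i = Rotation k l t"
  shows "potential d n C (Suc i) \<le> potential d n C i
    + 8 * condition_number (defining_matrix d C (Suc i))"
proof -
  have "valid_gate d (C ! i)"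
    using C i by (rule valid_gate_nth)
  then have kl: "k < l" "l < d" using g by auto
  define A A' B B' where
    "A = defining_matrix d C i" and "A' = defining_matrix d C (Suc i)" and
    "B = defining_matrix d (dual_circuit C) i" and "B' = defining_matrix d (dual_circuit C) (Suc i)"
  note defs = A_def A'_def B_def B'_def
  let ?p = "\<lambda>j. (A' $$ (k, j))\<^sup>2 + (A' $$ (l, j))\<^sup>2"
  let ?q = "\<lambda>j. (B' $$ (k, j))\<^sup>2 + (B' $$ (l, j))\<^sup>2"
  have col: "(\<Sum>r<d. entropy_term (A' $$ (r, j) * B' $$ (r, j)))
    \<le> (\<Sum>r<d. entropy_term (A $$ (r, j) * B $$ (r, j))) + 4 * (sqrt (?p j) * sqrt (?q j))"
    if j: "j < d" for j
  proof -
    have A': "A' $$ (r, j) = (if r = k then cos t * A $$ (k, j) + sin t * A $$ (l, j)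
        else if r = l then cos t * A $$ (l, j) - sin t * A $$ (k, j) else A $$ (r, j))"
      if "r < d" for r
      using kl j i that g by (simp add: defs defining_matrix_Suc defining_matrix_def[of d C i])
    have B': "B' $$ (r, j) = (if r = k then cos t * B $$ (k, j) + sin t * B $$ (l, j)
        else if r = l then cos t * B $$ (l, j) - sin t * B $$ (k, j) else B $$ (r, j))"
      if "r < d" for r
      using kl j i that g
      by (simp add: defs defining_matrix_Suc defining_matrix_def[of d "dual_circuit C" i])
    have rest: "(\<Sum>r\<in>{..<d} - {k, l}. entropy_term (A' $$ (r, j) * B' $$ (r, j)))
      = (\<Sum>r\<in>{..<d} - {k, l}. entropy_term (A $$ (r, j) * B $$ (r, j)))"
      by (intro sum.cong) (auto simp: A' B')
    have "entropy_term (A' $$ (k, j) * B' $$ (k, j)) + entropy_term (A' $$ (l, j) * B' $$ (l, j))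
      \<le> entropy_term (A $$ (k, j) * B $$ (k, j)) + entropy_term (A $$ (l, j) * B $$ (l, j))
        + 4 * (sqrt (?p j) * sqrt (?q j))"
    proof (rule rotation_entropy_change)
      show "(A $$ (k, j))\<^sup>2 + (A $$ (l, j))\<^sup>2 = ?p j"
        using kl rotation_preserves_product[of t "A $$ (k, j)" "A $$ (l, j)" "A $$ (k, j)" "A $$ (l, j)"]
        by (simp add: A' power2_eq_square)
      show "(B $$ (k, j))\<^sup>2 + (B $$ (l, j))\<^sup>2 = ?q j"
        using kl rotation_preserves_product[of t "B $$ (k, j)" "B $$ (l, j)" "B $$ (k, j)" "B $$ (l, j)"]
        by (simp add: B' power2_eq_square)
      show "A $$ (k, j) * B $$ (k, j) + A $$ (l, j) * B $$ (l, j)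
        = A' $$ (k, j) * B' $$ (k, j) + A' $$ (l, j) * B' $$ (l, j)"
        using kl rotation_preserves_product[of t "A $$ (k, j)" "A $$ (l, j)" "B $$ (k, j)" "B $$ (l, j)"]
        by (simp add: A' B')
    qed
    then show ?thesis
      by (simp add: sum_split_two[OF kl] rest)
  qed
  \<comment> \<open>Adding the remaining columns completes the rows \<open>k\<close> and
    \<open>l\<close>; Cauchy-Schwarz then bounds the sum by the norms of this pair of rows in
    \<open>A'\<close> and \<open>B'\<close>.\<close>
  have "(\<Sum>j<n. sqrt (?p j) * sqrt (?q j)) \<le> (\<Sum>j<d. sqrt (?p j) * sqrt (?q j))"
    using n by (intro sum_mono2) auto
  also have "\<dots> \<le> sqrt (\<Sum>j<d. ?p j) * sqrt (\<Sum>j<d. ?q j)"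
    using L2_set_mult_ineq[of "\<lambda>j. sqrt (?p j)" "\<lambda>j. sqrt (?q j)" "{..<d}"]
    by (simp add: L2_set_def)
  also have "\<dots> \<le> 2 * condition_number A'"
    unfolding A'_def B'_def using row_norms_le_condition_number[OF C, of "Suc i" k l] i kl by simp
  finally have cs: "(\<Sum>j<n. sqrt (?p j) * sqrt (?q j)) \<le> 2 * condition_number A'" .
  have "potential d n C (Suc i) = (\<Sum>j<n. \<Sum>r<d. entropy_term (A' $$ (r, j) * B' $$ (r, j)))"
    by (simp add: potential_def defs)
  also have "\<dots> \<le> (\<Sum>j<n. (\<Sum>r<d. entropy_term (A $$ (r, j) * B $$ (r, j)))
      + 4 * (sqrt (?p j) * sqrt (?q j)))"
    using col n by (intro sum_mono) auto
  also have "\<dots> = potential d n C i + 4 * (\<Sum>j<n. sqrt (?p j) * sqrt (?q j))"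
    by (simp add: potential_def defs sum.distrib sum_distrib_left)
  finally show ?thesis using cs by (simp add: A'_def)
qed

text \<open>Induction over prefixes: a constant gate is free, a rotation adds 1 to the count and at
  most \<open>8 * R\<close> to the potential.\<close>

lemma potential_le_rotation_count:
  assumes C: "valid_circuit d C" and R: "uniformly_well_conditioned d R C" and n: "n \<le> d"
    and "i \<le> length C"
  shows "potential d n C i \<le> 8 * R * real (rotation_count (take i C))"
  using assms(4)
proof (induction i)
  case 0
  then show ?case using n by (simp add: potential_0 rotation_count_def)
next
  case (Suc i)
  then have i: "i < length C"
    and IH: "potential d n C i \<le> 8 * R * real (rotation_count (take i C))" by auto
  show ?case
  proof (cases "C ! i")
    case (Rotation k l t)
    have "condition_number (defining_matrix d C (Suc i)) \<le> R"
      using R i by (simp add: uniformly_well_conditioned_def)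
    then show ?thesis
      using potential_Suc_Rotation[OF C i n Rotation] IH i
      by (simp add: rotation_count_def take_Suc_conv_app_nth Rotation algebra_simps)
  next
    case (Constant k c)
    then show ?thesis
      using potential_Suc_Constant[OF C i n Constant] IH i
      by (simp add: rotation_count_def take_Suc_conv_app_nth)
  qed
qed

subsection \<open>Fourier matrices are orthogonal and flat\<close>

text \<open>Only the summand at \<open>b\<close> changes, and the reduction modulo 2 does not affect
  a power of -1.\<close>

lemma minus_one_power_binary_dot_flip:
  assumes "b < k"
  shows "(- 1 :: real) ^ binary_dot k (flip_bit b r) s
    = (if bit s b then - 1 else 1) * (- 1) ^ binary_dot k r s"
proof -
  define e where "e r = (\<Sum>c<k. of_bool (bit r c) * of_bool (bit s c) :: nat)" for r :: nat
  define e' where "e' r = (\<Sum>c\<in>{..<k} - {b}. of_bool (bit r c) * of_bool (bit s c) :: nat)" for r :: nat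
  have e: "e r = of_bool (bit r b) * of_bool (bit s b) + e' r" for r
    unfolding e_def e'_def using assms by (intro sum.remove) auto
  have "e' (flip_bit b r) = e' r"
    unfolding e'_def by (intro sum.cong) (auto simp: bit_flip_bit_iff)
  then have "(- 1 :: real) ^ e (flip_bit b r) = (if bit s b then - 1 else 1) * (- 1) ^ e r"
    unfolding e by (auto simp: bit_flip_bit_iff power_add)
  moreover have "(- 1 :: real) ^ binary_dot k r s = (- 1) ^ e r" for r
    by (simp add: binary_dot_def minus_one_power_iff flip: e_def)
  ultimately show ?thesis by simp
qed

lemma flip_bit_less_power2:
  fixes r :: nat
  assumes "b < k" "r < 2 ^ k"
  shows "flip_bit b r < 2 ^ k"
  using assms by (simp add: take_bit_flip_bit_eq flip: take_bit_nat_eq_self_iff)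

text \<open>If \<open>i\<close> and \<open>j\<close> differ at bit \<open>b\<close>, flipping bit
  \<open>b\<close> of \<open>r\<close> permutes the range and negates the summand, so the sum is its
  own negative.\<close>

lemma walsh_characters_orthogonal:
  fixes i j :: nat
  assumes "i < 2 ^ k" "j < 2 ^ k"
  shows "(\<Sum>r<2 ^ k. (- 1) ^ binary_dot k r i * (- 1) ^ binary_dot k r j)
    = (if i = j then 2 ^ k else 0 :: real)"
proof (cases "i = j")
  case True
  then show ?thesis by (simp flip: power_mult_distrib)
next
  case False
  then obtain b where b: "bit i b \<noteq> bit j b"
    by (auto simp: bit_eq_iff)
  have "b < k"
  proof (rule ccontr)
    assume "\<not> b < k"
    then have "\<not> bit (take_bit k i) b" "\<not> bit (take_bit k j) b"
      by (simp_all add: bit_take_bit_iff)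
    moreover have "take_bit k i = i" "take_bit k j = j"
      using assms by (simp_all add: take_bit_nat_eq_self_iff)
    ultimately show False using b by simp
  qed
  define f where "f r = (- 1) ^ binary_dot k r i * (- 1 :: real) ^ binary_dot k r j" for r
  have flip: "f (flip_bit b r) = - f r" for r
    using b \<open>b < k\<close> by (auto simp: f_def minus_one_power_binary_dot_flip)
  have flip_flip: "flip_bit b (flip_bit b r) = r" for r :: nat
    by (rule bit_eqI) (auto simp: bit_flip_bit_iff)
  have "(\<Sum>r<2 ^ k. f r) = (\<Sum>r<2 ^ k. f (flip_bit b r))"
    by (rule sum.reindex_bij_witness[of _ "flip_bit b" "flip_bit b"])
      (use \<open>b < k\<close> in \<open>auto simp: flip_flip flip_bit_less_power2\<close>)
  also have "\<dots> = - (\<Sum>r<2 ^ k. f r)"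
    by (simp add: flip sum_negf)
  finally show ?thesis
    using False by (simp add: f_def)
qed

text \<open>The interface through which both kinds of Fourier matrix enter: \<open>H\<close> is
  \<open>n\<close> for Walsh-Hadamard and \<open>n div 2\<close> for the DFT.\<close>

definition flat_orthogonal :: "nat \<Rightarrow> real \<Rightarrow> real mat \<Rightarrow> bool" where
  "flat_orthogonal n H F \<longleftrightarrow> F \<in> carrier_mat n n \<and> transpose_mat F * F = 1\<^sub>m n \<and>
     (\<forall>i<n. \<forall>j<n. (F $$ (i, j))\<^sup>2 \<le> 1 / H)"

lemma walsh_hadamard_flat_orthogonal:
  assumes "walsh_hadamard_matrix n F"
  shows "flat_orthogonal n (real n) F"
proof -
  obtain k where n: "n = 2 ^ k"
    and F: "F = mat n n (\<lambda>(i, j). (- 1) ^ binary_dot k i j / sqrt (real n))"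
    using assms by (auto simp: walsh_hadamard_matrix_def)
  have pos: "real n > 0" by (simp add: n)
  have "transpose_mat F * F = 1\<^sub>m n"
  proof (rule eq_matI)
    fix i j assume "i < dim_row (1\<^sub>m n :: real mat)" "j < dim_col (1\<^sub>m n :: real mat)"
    then have ij: "i < n" "j < n" by auto
    have "(transpose_mat F * F) $$ (i, j)
      = (\<Sum>r<n. (- 1) ^ binary_dot k r i * (- 1) ^ binary_dot k r j / real n)"
      using ij by (simp add: F scalar_prod_def atLeast0LessThan)
    also have "\<dots> = (if i = j then 1 else 0)"
      using walsh_characters_orthogonal[of i k j] ij pos
      by (simp add: n flip: sum_divide_distrib)
    finally show "(transpose_mat F * F) $$ (i, j) = 1\<^sub>m n $$ (i, j)"
      using ij by simp
  qed (auto simp: F)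
  moreover have "(F $$ (i, j))\<^sup>2 \<le> 1 / real n" if "i < n" "j < n" for i j
    using that by (simp add: F power_divide flip: power_mult)
  ultimately show ?thesis
    by (auto simp: flat_orthogonal_def F)
qed

section \<open>Unitarity of the complex DFT\<close>

lemma dft_matrix_index:
  assumes "k < h" "l < h"
  shows "dft_matrix h $$ (k, l) = cis (- (2 * pi * real k * real l / real h)) / of_real (sqrt (real h))"
  using assms by (simp add: dft_matrix_def cis_conv_exp mult_ac)

lemma norm_dft_matrix_index:
  assumes "k < h" "l < h"
  shows "cmod (dft_matrix h $$ (k, l)) = 1 / sqrt (real h)"
  using assms by (simp add: dft_matrix_index norm_divide)

text \<open>The sum is geometric with ratio \<open>cis \<theta>\<close>, an \<open>h\<close>-th root
  of unity that is 1 only for \<open>a = b\<close>.\<close>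

lemma dft_columns_orthonormal:
  assumes "a < h" "b < h"
  shows "(\<Sum>k<h. dft_matrix h $$ (k, a) * cnj (dft_matrix h $$ (k, b))) = (if a = b then 1 else 0)"
proof -
  define \<theta> where "\<theta> = 2 * pi * ((real b - real a) / real h)"
  have h: "real h > 0" using assms by simp
  have "dft_matrix h $$ (k, a) * cnj (dft_matrix h $$ (k, b)) = cis \<theta> ^ k / of_nat h"
    if "k < h" for k
  proof -
    have "dft_matrix h $$ (k, a) * cnj (dft_matrix h $$ (k, b))
      = cis (- (2 * pi * real k * real a / real h) + 2 * pi * real k * real b / real h)
        / (of_real (sqrt (real h)) * of_real (sqrt (real h)))"
      using that assms by (simp add: dft_matrix_index cis_cnj cis_mult)
    also have "- (2 * pi * real k * real a / real h) + 2 * pi * real k * real b / real h = real k * \<theta>"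
      using h by (simp add: \<theta>_def field_simps)
    also have "complex_of_real (sqrt (real h)) * of_real (sqrt (real h)) = of_nat h"
      by (simp flip: of_real_mult)
    finally show ?thesis by (simp add: DeMoivre)
  qed
  then have sum: "(\<Sum>k<h. dft_matrix h $$ (k, a) * cnj (dft_matrix h $$ (k, b)))
    = (\<Sum>k<h. cis \<theta> ^ k) / of_nat h"
    by (simp add: sum_divide_distrib)
  show ?thesis
  proof (cases "a = b")
    case True
    then show ?thesis using h sum by (simp add: \<theta>_def)
  next
    case False
    \<comment> \<open>A ratio of 1 would make \<open>h\<close> divide \<open>b - a\<close>, whose
      absolute value is below \<open>h\<close>.\<close>
    have "cis \<theta> \<noteq> 1"
    proof
      assume "cis \<theta> = 1"
      then have "cos \<theta> = 1" by (simp add: complex_eq_iff)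
      then obtain m :: int where "\<theta> = of_int m * 2 * pi"
        by (auto simp: cos_one_2pi_int)
      then have "2 * pi * ((real b - real a) / real h) = 2 * pi * of_int m"
        unfolding \<theta>_def by (simp only: mult_ac)
      then have "(real b - real a) / real h = of_int m"
        unfolding mult_cancel_left by simp
      then have "of_int (int b - int a) = (of_int (m * int h) :: real)"
        using h by (simp add: field_simps)
      then have m: "int b - int a = m * int h"
        by (simp only: of_int_eq_iff)
      have "\<bar>m * int h\<bar> < int h"
        using assms unfolding m[symmetric] by linarith
      then have "m = 0"
        using assms by (simp add: abs_mult)
      with m False show False by simp
    qed
    moreover have "cis \<theta> ^ h = 1"
    proof -
      have "real h * \<theta> = 2 * pi * of_int (int b - int a)"
        using h by (simp add: \<theta>_def)
      then show ?thesis
        by (simp only: DeMoivre) (simp only: cis_multiple_2pi Ints_of_int)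
    qed
    ultimately show ?thesis
      using False by (simp add: sum geometric_sum)
  qed
qed

text \<open>Expanding both images and summing over \<open>k\<close> first leaves only the diagonal
  terms \<open>a = b\<close>.\<close>

lemma dft_preserves_product:
  assumes "z \<in> carrier_vec h" "w \<in> carrier_vec h"
  shows "(\<Sum>k<h. (dft_matrix h *\<^sub>v z) $ k * cnj ((dft_matrix h *\<^sub>v w) $ k))
    = (\<Sum>k<h. z $ k * cnj (w $ k))"
proof -
  have D: "dft_matrix h \<in> carrier_mat h h" by (simp add: dft_matrix_def)
  have mult: "(dft_matrix h *\<^sub>v v) $ k = (\<Sum>a<h. dft_matrix h $$ (k, a) * v $ a)"
    if "k < h" "v \<in> carrier_vec h" for k v
    using that D by (auto simp: scalar_prod_def atLeast0LessThan)
  have "(\<Sum>k<h. (dft_matrix h *\<^sub>v z) $ k * cnj ((dft_matrix h *\<^sub>v w) $ k))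
    = (\<Sum>k<h. \<Sum>a<h. \<Sum>b<h. (z $ a * cnj (w $ b)) *
        (dft_matrix h $$ (k, a) * cnj (dft_matrix h $$ (k, b))))"
    using assms by (intro sum.cong) (auto simp: mult sum_product mult_ac)
  also have "\<dots> = (\<Sum>a<h. \<Sum>b<h. \<Sum>k<h. (z $ a * cnj (w $ b)) *
        (dft_matrix h $$ (k, a) * cnj (dft_matrix h $$ (k, b))))"
    by (subst sum.swap) (intro sum.cong sum.swap refl)
  also have "\<dots> = (\<Sum>a<h. \<Sum>b<h. (z $ a * cnj (w $ b)) * (if a = b then 1 else 0))"
    by (intro sum.cong refl) (auto simp: dft_columns_orthonormal simp flip: sum_distrib_left)
  also have "\<dots> = (\<Sum>k<h. z $ k * cnj (w $ k))"
    by (simp add: if_distrib[of "\<lambda>x. _ * x"] cong: if_cong)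
  finally show ?thesis .
qed

section \<open>The real form of the DFT\<close>

lemma Re_neq_Im: "Re \<noteq> Im"
proof
  assume "Re = Im"
  then have "Re 1 = Im 1" by (rule fun_cong)
  then show False by simp
qed

text \<open>\<open>Re (z * cnj w)\<close> is \<open>Re z * Re w + Im z * Im w\<close>, and a layout
  stores every part exactly once.\<close>

lemma store_product:
  assumes "storage_layout n p"
  shows "(\<Sum>i<n. store n p z $ i * store n p w $ i) = Re (\<Sum>k<n div 2. z $ k * cnj (w $ k))"
proof -
  have bij: "bij_betw p {..<n} ({Re, Im} \<times> {..<n div 2})"
    using assms by (simp add: storage_layout_def)
  have "(\<Sum>i<n. store n p z $ i * store n p w $ i)
    = (\<Sum>i<n. (\<lambda>q. fst q (z $ snd q) * fst q (w $ snd q)) (p i))"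
    by (simp add: store_def)
  also have "\<dots> = (\<Sum>q\<in>{Re, Im} \<times> {..<n div 2}. fst q (z $ snd q) * fst q (w $ snd q))"
    by (rule sum.reindex_bij_betw[OF bij])
  also have "\<dots> = (\<Sum>f\<in>{Re, Im}. \<Sum>k<n div 2. f (z $ k) * f (w $ k))"
    by (simp add: sum.cartesian_product case_prod_unfold)
  also have "\<dots> = Re (\<Sum>k<n div 2. z $ k * cnj (w $ k))"
    using Re_neq_Im by (simp add: sum.distrib)
  finally show ?thesis .
qed

text \<open>Column \<open>j\<close> of \<open>F\<close> is the stored DFT image of the complex
  vector that is stored as unit vector \<open>j\<close>. Orthogonality then follows from unitarity,
  flatness from the common modulus of all DFT entries.\<close>

lemma real_dft_flat_orthogonal:
  assumes "real_dft_matrix n F"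
  shows "flat_orthogonal n (real (n div 2)) F"
proof -
  let ?h = "n div 2"
  obtain p where F: "F \<in> carrier_mat n n" and p: "storage_layout n p"
    and Fp: "\<And>z. z \<in> carrier_vec ?h \<Longrightarrow> F *\<^sub>v store n p z = store n p (dft_matrix ?h *\<^sub>v z)"
    using assms by (auto simp: real_dft_matrix_def)
  have bij: "bij_betw p {..<n} ({Re, Im} \<times> {..<?h})"
    using p by (simp add: storage_layout_def)
  have p_mem: "fst (p i) = Re \<or> fst (p i) = Im" "snd (p i) < ?h" if "i < n" for i
    using bij_betwE[OF bij] that by (auto simp: mem_Times_iff)
  have p_inj: "i = j" if "i < n" "j < n" "fst (p i) = fst (p j)" "snd (p i) = snd (p j)" for i j
    using bij_betw_imp_inj_on[OF bij] that by (auto simp: inj_on_def prod_eq_iff)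
  \<comment> \<open>Putting 1 or the imaginary unit in position \<open>snd (p j)\<close> sets
    exactly the part kept in coordinate \<open>j\<close>.\<close>
  define u where "u j = (if fst (p j) = Re then 1 else \<i>)" for j
  define e where "e j = vec ?h (\<lambda>k. if k = snd (p j) then u j else 0)" for j
  have e: "e j \<in> carrier_vec ?h" for j by (simp add: e_def)
  have unit: "store n p (e j) = unit_vec n j" if "j < n" for j
  proof (rule eq_vecI)
    fix i assume "i < dim_vec (unit_vec n j :: real vec)"
    then have i: "i < n" by simp
    show "store n p (e j) $ i = unit_vec n j $ i"
    proof (cases "i = j")
      case True
      then show ?thesis
        using i p_mem[OF i] Re_neq_Im by (auto simp: store_def e_def u_def)
    next
      case False
      then show ?thesis
        using i that p_mem[OF i] p_mem[OF that] p_inj[OF i that] Re_neq_Im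
        by (auto simp: store_def e_def u_def)
    qed
  qed (simp add: store_def)
  have col: "F $$ (i, j) = store n p (dft_matrix ?h *\<^sub>v e j) $ i" if "i < n" "j < n" for i j
  proof -
    have "F $$ (i, j) = (F *\<^sub>v unit_vec n j) $ i"
      using F that by simp
    then show ?thesis
      by (simp add: Fp[OF e] flip: unit[OF that(2)])
  qed
  have "transpose_mat F * F = 1\<^sub>m n"
  proof (rule eq_matI)
    fix i j assume "i < dim_row (1\<^sub>m n :: real mat)" "j < dim_col (1\<^sub>m n :: real mat)"
    then have ij: "i < n" "j < n" by auto
    have "(transpose_mat F * F) $$ (i, j) = (\<Sum>r<n. F $$ (r, i) * F $$ (r, j))"
      using ij F by (simp add: scalar_prod_def atLeast0LessThan)
    also have "\<dots> = (\<Sum>r<n. store n p (dft_matrix ?h *\<^sub>v e i) $ r * store n p (dft_matrix ?h *\<^sub>v e j) $ r)"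
      using ij by (simp add: col)
    also have "\<dots> = (\<Sum>r<n. store n p (e i) $ r * store n p (e j) $ r)"
      unfolding store_product[OF p] by (simp only: dft_preserves_product[OF e e])
    also have "\<dots> = (\<Sum>r<n. if r = i then (if i = j then 1 else 0) else 0)"
      using ij by (intro sum.cong) (auto simp: unit)
    also have "\<dots> = 1\<^sub>m n $$ (i, j)"
      using ij by simp
    finally show "(transpose_mat F * F) $$ (i, j) = 1\<^sub>m n $$ (i, j)" .
  qed (use F in auto)
  moreover have "(F $$ (i, j))\<^sup>2 \<le> 1 / real ?h" if ij: "i < n" "j < n" for i j
  proof -
    have D: "dft_matrix ?h \<in> carrier_mat ?h ?h" by (simp add: dft_matrix_def)
    let ?d = "dft_matrix ?h $$ (snd (p i), snd (p j)) * u j"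
    have "(dft_matrix ?h *\<^sub>v e j) $ snd (p i)
      = (\<Sum>l<?h. dft_matrix ?h $$ (snd (p i), l) * (if l = snd (p j) then u j else 0))"
      using p_mem(2)[OF ij(1)] D
      by (simp add: e_def scalar_prod_def atLeast0LessThan)
    also have "\<dots> = ?d"
      using p_mem(2)[OF ij(2)] by (simp add: if_distrib[of "\<lambda>x. _ * x"] cong: if_cong)
    finally have "F $$ (i, j) = fst (p i) ?d"
      using ij by (simp add: col store_def)
    moreover have "\<bar>fst (p i) ?d\<bar> \<le> cmod ?d"
      using p_mem(1)[OF ij(1)] abs_Re_le_cmod[of ?d] abs_Im_le_cmod[of ?d] by auto
    moreover have "cmod ?d = 1 / sqrt (real ?h)"
      using ij p_mem by (auto simp: norm_mult norm_dft_matrix_index u_def)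
    ultimately have "\<bar>F $$ (i, j)\<bar> \<le> 1 / sqrt (real ?h)" by simp
    then have "\<bar>F $$ (i, j)\<bar>\<^sup>2 \<le> (1 / sqrt (real ?h))\<^sup>2"
      by (intro power_mono) auto
    then show ?thesis by (simp add: power_divide)
  qed
  ultimately show ?thesis using F by (simp add: flat_orthogonal_def)
qed

subsection \<open>The final potential\<close>

text \<open>Biorthogonality and the zero block force the upper rows of the inverse transpose to
  agree with \<open>F\<close> on the input columns. The products are therefore squared entries of
  \<open>F\<close> in these rows, and 0 below, where \<open>A\<close> vanishes.\<close>

lemma potential_final_ge:
  assumes C: "valid_circuit (n + N) C"
    and F: "flat_orthogonal n H F" "H > 0"
    and top: "submatrix (defining_matrix (n + N) C (length C)) {..<n} {..<n} = F"
    and bottom: "submatrix (defining_matrix (n + N) C (length C)) {n..<n + N} {..<n} = 0\<^sub>m N n"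
  shows "potential (n + N) n C (length C) \<ge> real n * ln H"
proof -
  define A B where "A = defining_matrix (n + N) C (length C)"
    and "B = defining_matrix (n + N) (dual_circuit C) (length C)"
  have A: "A \<in> carrier_mat (n + N) (n + N)" and B: "B \<in> carrier_mat (n + N) (n + N)"
    by (simp_all add: A_def B_def defining_matrix_def)
  have Fc: "F \<in> carrier_mat n n" and orth: "transpose_mat F * F = 1\<^sub>m n"
    and flat: "\<And>i j. i < n \<Longrightarrow> j < n \<Longrightarrow> (F $$ (i, j))\<^sup>2 \<le> 1 / H"
    using F(1) by (auto simp: flat_orthogonal_def)
  \<comment> \<open>\<open>submatrix\<close> renumbers rows and columns by counting the smaller
    chosen indices, so row \<open>r\<close> of the whole matrix becomes row \<open>r - n\<close> of
    the lower block.\<close>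
  have card_top: "card {a \<in> {..<n}. a < r} = r" if "r < n" for r
  proof -
    have "{a \<in> {..<n}. a < r} = {..<r}" using that by auto
    then show ?thesis by simp
  qed
  have card_bottom: "card {a \<in> {n..<n + N}. a < r} = r - n" if "r < n + N" for r
  proof -
    have "{a \<in> {n..<n + N}. a < r} = {n..<r}" using that by auto
    then show ?thesis by simp
  qed
  have A_top: "A $$ (r, j) = F $$ (r, j)" if "r < n" "j < n" for r j
    using submatrix_index_card[of r A j "{..<n}" "{..<n}"] that A
    unfolding card_top[OF that(1)] card_top[OF that(2)] top[folded A_def] by simp
  have A_bottom: "A $$ (r, j) = 0" if "n \<le> r" "r < n + N" "j < n" for r j
    using submatrix_index_card[of r A j "{n..<n + N}" "{..<n}"] that A
    unfolding card_bottom[OF that(2)] card_top[OF that(3)] bottom[folded A_def] by simp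
  have split: "(\<Sum>r<n + N. f r) = (\<Sum>r<n. f r) + (\<Sum>r\<in>{n..<n + N}. f r)" for f :: "nat \<Rightarrow> real"
  proof -
    have "{..<n + N} = {..<n} \<union> {n..<n + N}" by auto
    then show ?thesis by (simp add: sum.union_disjoint ivl_disj_int)
  qed
  define B' where "B' = mat n n (\<lambda>(r, j). B $$ (r, j))"
  have B': "B' \<in> carrier_mat n n" by (simp add: B'_def)
  \<comment> \<open>In \<open>transpose_mat B * A\<close> the rows from \<open>n\<close> on drop
    out, since \<open>A\<close> is zero there on the input columns.\<close>
  have "transpose_mat B' * F = 1\<^sub>m n"
  proof (rule eq_matI)
    fix i j assume "i < dim_row (1\<^sub>m n :: real mat)" "j < dim_col (1\<^sub>m n :: real mat)"
    then have ij: "i < n" "j < n" by auto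
    have "(transpose_mat B' * F) $$ (i, j) = (\<Sum>r<n. B $$ (r, i) * F $$ (r, j))"
      using ij Fc by (simp add: B'_def scalar_prod_def atLeast0LessThan)
    also have "\<dots> = (\<Sum>r<n + N. B $$ (r, i) * A $$ (r, j))"
      using ij by (simp add: split A_top A_bottom)
    also have "\<dots> = (transpose_mat B * A) $$ (i, j)"
      using ij A B by (simp add: scalar_prod_def atLeast0LessThan)
    also have "\<dots> = 1\<^sub>m n $$ (i, j)"
      using ij transpose_dual_circuit_inverse[OF C, of "length C"] by (simp add: A_def B_def)
    finally show "(transpose_mat B' * F) $$ (i, j) = 1\<^sub>m n $$ (i, j)" .
  qed (use B' Fc in auto)
  \<comment> \<open>\<open>transpose_mat B'\<close> and \<open>transpose_mat F\<close> are left
    inverses of the same square matrix, hence equal.\<close>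
  moreover have "F * transpose_mat F = 1\<^sub>m n"
    using Fc orth by (intro mat_mult_left_right_inverse[of "transpose_mat F" n F]) auto
  ultimately have "transpose_mat B' = transpose_mat F"
    using assoc_mult_mat[of "transpose_mat B'" n n F n "transpose_mat F" n] B' Fc by simp
  then have "B' = F" by (metis transpose_transpose)
  then have B_top: "B $$ (r, j) = F $$ (r, j)" if "r < n" "j < n" for r j
    using that by (auto simp: B'_def)
  \<comment> \<open>The diagonal entries of \<open>transpose_mat F * F\<close> are squared column
    norms, all equal to 1; this spreads \<open>ln H\<close> over the entries.\<close>
  have "real n * ln H = (\<Sum>j<n. (transpose_mat F * F) $$ (j, j) * ln H)"
    by (simp add: orth)
  also have "\<dots> = (\<Sum>j<n. \<Sum>r<n. (F $$ (r, j))\<^sup>2 * ln H)"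
    using Fc by (simp add: scalar_prod_def atLeast0LessThan power2_eq_square sum_distrib_right)
  also have "\<dots> \<le> (\<Sum>j<n. \<Sum>r<n. entropy_term (F $$ (r, j) * F $$ (r, j)))"
    using F(2) flat by (intro sum_mono entropy_term_square_ge) auto
  also have "\<dots> = potential (n + N) n C (length C)"
    by (simp add: potential_def split A_top B_top A_bottom flip: A_def B_def)
  finally show ?thesis .
qed

section \<open>Comparison of \<open>H\<close> with \<open>n\<close> and the resulting count\<close>

text \<open>For the DFT of order \<open>h\<close>, \<open>H\<close> is \<open>h = n / 2\<close>, and
  \<open>2 * h \<le> h\<^sup>2\<close> holds once \<open>h \<ge> 2\<close>. At order 1, excluded by
  \<open>n > 2\<close>, \<open>ln H\<close> would be 0. For Walsh-Hadamard \<open>H\<close> is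
  \<open>n\<close> itself.\<close>

lemma fourier_flat_orthogonal:
  assumes "even n" and F: "(real_dft_matrix n F \<and> n > 2) \<or> walsh_hadamard_matrix n F"
  obtains H where "flat_orthogonal n H F" "H > 0" "ln (real n) \<le> 2 * ln H"
  using F
proof
  assume "real_dft_matrix n F \<and> n > 2"
  then have dft: "real_dft_matrix n F" and "n > 2" by auto
  with \<open>even n\<close> obtain h where h: "n = 2 * h" "h \<ge> 2" by (auto elim!: evenE)
  have "2 * ln (real h) = ln (real h ^ 2)"
    using h by (simp add: ln_realpow)
  moreover have "real n \<le> real h ^ 2"
    using h by (simp add: power2_eq_square)
  ultimately have "ln (real n) \<le> 2 * ln (real h)"
    using h by simp
  then show thesis
    using that[of "real h"] real_dft_flat_orthogonal[OF dft] h by simp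
next
  assume wh: "walsh_hadamard_matrix n F"
  then have "n \<ge> 1" by (auto simp: walsh_hadamard_matrix_def)
  then show thesis
    using that[of "real n"] walsh_hadamard_flat_orthogonal[OF wh] by simp
qed

theorem theorem2:
  shows "\<exists>c::real. c > 0 \<and>
    (\<forall>(n::nat) (N::nat) (R::real) (F::real mat) (C::circuit).
      even n \<longrightarrow>
      real N \<le> real n * log 2 (real n) \<longrightarrow>
      R > 1 \<longrightarrow>
      (real_dft_matrix n F \<and> n > 2) \<or> walsh_hadamard_matrix n F \<longrightarrow>
      valid_circuit (n + N) C \<longrightarrow>
      uniformly_well_conditioned (n + N) R C \<longrightarrow>
      submatrix (defining_matrix (n + N) C (length C)) {..<n} {..<n} = F \<longrightarrow>
      submatrix (defining_matrix (n + N) C (length C)) {n..<n + N} {..<n} = 0\<^sub>m N n \<longrightarrow>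
      real (rotation_count C) \<ge> c * inverse R * real n * log 2 (real n))"
\<comment> \<open>The 16 is the 8 per rotation times the 2 in
  \<open>ln (real n) \<le> 2 * ln H\<close>; \<open>ln 2\<close> converts to logarithms of base
  2.\<close>
proof (intro exI[of _ "ln 2 / 16 :: real"] conjI allI impI)
  fix n N :: nat and R :: real and F :: "real mat" and C :: circuit
  assume "even n" and R: "R > 1"
    and F: "(real_dft_matrix n F \<and> n > 2) \<or> walsh_hadamard_matrix n F"
    and C: "valid_circuit (n + N) C" "uniformly_well_conditioned (n + N) R C"
    and sub: "submatrix (defining_matrix (n + N) C (length C)) {..<n} {..<n} = F"
      "submatrix (defining_matrix (n + N) C (length C)) {n..<n + N} {..<n} = 0\<^sub>m N n"
  obtain H where H: "flat_orthogonal n H F" "H > 0" "ln (real n) \<le> 2 * ln H"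
    using fourier_flat_orthogonal[OF \<open>even n\<close> F] .
  have "real n * ln (real n) \<le> 2 * (real n * ln H)"
    using mult_left_mono[OF H(3), of "real n"] by simp
  also have "real n * ln H \<le> potential (n + N) n C (length C)"
    by (rule potential_final_ge[OF C(1) H(1,2) sub])
  also have "\<dots> \<le> 8 * R * real (rotation_count C)"
    using potential_le_rotation_count[OF C, of n "length C"] by simp
  finally have "real n * ln (real n) \<le> 16 * R * real (rotation_count C)" by simp
  then show "ln 2 / 16 * inverse R * real n * log 2 (real n) \<le> real (rotation_count C)"
    using R by (simp add: log_def field_simps)
qed simp

end
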